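(* $J\subset BMOA$.
   Context: $D$ is the open unit disk in the complex plane and $T$ is the unit circle. $M$ is the Banach space of all complex-valued (finite) Borel measures on $T$ with the total variation norm. For $\mu\in M$ and $z\in D$ define $$J_\mu(z)=\int_T \log\left(\frac{1-\xi z}{1-\overline{\xi}z}\right)d\mu(\xi),$$ where $\log$ denotes the branch that is analytic in $z\in D$ and vanishes at $z=0$ (the principal branch). Set $J=\{f: f=J_\mu \text{ for some } \mu\in M\}$, a class of analytic functions on $D$. $BMOA$ is the usual space of analytic functions of bounded mean oscillation on $D$, i.e. functions in the Hardy space $H^1$ whose boundary values on $T$ have bounded mean oscillation; equivalently, it is the dual of $H^1$ under the pairing $\langle f,h\rangle=\lim_{r\to1^-}\int_T\overline{f(r\xi)}\,h(\xi)\,dm(\xi)$, where $m$ is normalized Lebesgue measure on $T$. *)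

theory Defs
  imports "HOL-Complex_Analysis.Complex_Analysis"
begin

definition circle_borel :: "complex measure" where
  "circle_borel = restrict_space borel (sphere 0 1)"

text \<open>Complex Borel measures on the unit circle, as countably additive complex-valued set functions
  (hence automatically of finite total variation). Values on non-Borel sets are irrelevant.\<close>

definition complex_borel_measures :: "(complex set \<Rightarrow> complex) set" where
  "complex_borel_measures = {\<mu>. \<forall>A :: nat \<Rightarrow> complex set.
     range A \<subseteq> sets circle_borel \<longrightarrow> disjoint_family A \<longrightarrow> (\<lambda>i. \<mu> (A i)) sums \<mu> (\<Union>i. A i)}"

text \<open>The positive part of the Jordan decomposition of a signed measure \<open>\<nu>\<close>,
  i.e. \<open>A \<mapsto> sup {\<nu> B | B \<subseteq> A}\<close>; the negative part of \<open>\<nu>\<close> is the positive part of \<open>- \<nu>\<close>.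
  The coercion \<open>ennreal\<close> sends negative reals to \<open>0\<close>, which is harmless as \<open>B = {}\<close> contributes \<open>0\<close>.\<close>

definition positive_variation :: "(complex set \<Rightarrow> real) \<Rightarrow> complex measure" where
  "positive_variation \<nu> = measure_of (sphere 0 1) (sets circle_borel)
     (\<lambda>A. SUP B\<in>{B \<in> sets circle_borel. B \<subseteq> A}. ennreal (\<nu> B))"

definition complex_measure_integral :: "(complex set \<Rightarrow> complex) \<Rightarrow> (complex \<Rightarrow> complex) \<Rightarrow> complex" where
  "complex_measure_integral \<mu> f =
     ((\<integral>\<xi>. f \<xi> \<partial>positive_variation (\<lambda>A. Re (\<mu> A))) - (\<integral>\<xi>. f \<xi> \<partial>positive_variation (\<lambda>A. - Re (\<mu> A))))
     + \<i> * ((\<integral>\<xi>. f \<xi> \<partial>positive_variation (\<lambda>A. Im (\<mu> A))) - (\<integral>\<xi>. f \<xi> \<partial>positive_variation (\<lambda>A. - Im (\<mu> A))))"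

text \<open>For \<open>|\<xi>| = 1\<close> and \<open>|z| < 1\<close> numerator and denominator lie in the open right half-plane, so the
  quotient avoids the branch cut of \<^const>\<open>Ln\<close>, which is therefore the analytic branch vanishing
  at \<open>z = 0\<close>.\<close>

definition J_fun :: "(complex set \<Rightarrow> complex) \<Rightarrow> complex \<Rightarrow> complex" where
  "J_fun \<mu> z = complex_measure_integral \<mu> (\<lambda>\<xi>. Ln ((1 - \<xi> * z) / (1 - cnj \<xi> * z)))"

text \<open>Functions on the disk are represented by total functions whose values outside the disk are
  irrelevant, here and in the spaces below.\<close>

definition J_class :: "(complex \<Rightarrow> complex) set" where
  "J_class = {f. \<exists>\<mu>\<in>complex_borel_measures. \<forall>z\<in>ball 0 1. f z = J_fun \<mu> z}"

definition hardy_H1 :: "(complex \<Rightarrow> complex) set" where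
  "hardy_H1 = {f. f holomorphic_on ball 0 1 \<and>
     bdd_above ((\<lambda>r. 1 / (2 * pi) * (LINT t:{0..2 * pi}|lebesgue. norm (f (of_real r * cis t)))) ` {0..<1})}"

text \<open>Radial limits; for functions in \<^const>\<open>hardy_H1\<close> they exist almost everywhere on the circle
  (Fatou), and the arbitrary values of \<^const>\<open>Lim\<close> on the exceptional null set do not matter.\<close>

definition boundary_value :: "(complex \<Rightarrow> complex) \<Rightarrow> complex \<Rightarrow> complex" where
  "boundary_value f \<zeta> = Lim (at_left (1::real)) (\<lambda>r. f (of_real r * \<zeta>))"

text \<open>The arcs of the circle are the sets \<open>cis ` {a..b}\<close> with \<open>a < b \<le> a + 2 * pi\<close>.\<close>

definition arc_mean :: "(complex \<Rightarrow> complex) \<Rightarrow> real \<Rightarrow> real \<Rightarrow> complex" where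
  "arc_mean g a b = (LINT t:{a..b}|lebesgue. g (cis t)) / of_real (b - a)"

definition BMO_circle :: "(complex \<Rightarrow> complex) set" where
  "BMO_circle = {g. set_integrable lebesgue {0..2 * pi} (\<lambda>t. g (cis t)) \<and>
     (\<exists>K. \<forall>a b. a < b \<and> b \<le> a + 2 * pi \<longrightarrow>
        1 / (b - a) * (LINT t:{a..b}|lebesgue. norm (g (cis t) - arc_mean g a b)) \<le> K)}"

definition BMOA :: "(complex \<Rightarrow> complex) set" where
  "BMOA = {f \<in> hardy_H1. boundary_value f \<in> BMO_circle}"

end

theory Submission
  imports Defs "HOL-Real_Asymp.Real_Asymp"
begin

text \<open>
  The function \<open>log (1 - \<zeta>)\<close> has bounded mean oscillation on the circle, because
  \<open>log |t|\<close> has bounded mean oscillation on the line and the argument of \<open>1 - \<zeta>\<close> is bounded.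
  Rotations do not change mean oscillation, so \<open>log (1 - \<xi> \<zeta>)\<close> oscillates on every arc by at most
  an absolute constant, uniformly in \<open>\<xi>\<close> on the circle (\<open>kernel_oscillation\<close>). Averaging over \<open>\<xi>\<close>
  against a finite measure \<open>m\<close> keeps the bound by Fubini's theorem: subtract from the kernel, for each
  \<open>\<xi>\<close>, its mean over the arc, and exchange the integrals (\<open>boundary_potential_oscillation\<close>).

  It remains to identify the average of the boundary kernels as the radial boundary values of the
  potential \<open>z \<mapsto> \<integral> log (1 - \<xi> z) dm(\<xi>)\<close>, and to see that the potential is in \<open>H\<^sup>1\<close>. Both follow from
  \<open>|1 - \<zeta>| \<le> 2 |1 - r \<zeta>|\<close>, by which \<open>|log (1 - \<zeta>)| + 5\<close> dominates \<open>|log (1 - r \<zeta>)|\<close> for all \<open>r\<close>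
  (\<open>radial_kernel_bound\<close>): at almost every boundary point the kernel is \<open>m\<close>-integrable, so dominated
  convergence gives the radial limit, and the same majorant, integrated over the circle, bounds the
  \<open>H\<^sup>1\<close> means (\<open>radial_limit\<close>).

  Finally \<open>J_\<mu>\<close> is a linear combination of eight such potentials: \<open>\<mu>\<close> is split into the positive and
  negative parts of its real and imaginary part, which are finite measures because a countably
  additive real set function is bounded (\<open>countably_additive_bounded\<close>), and the kernel into
  \<open>log (1 - \<xi> z)\<close> and \<open>log (1 - \<xi>\<^sup>* z)\<close>, with \<open>\<xi>\<^sup>*\<close> the conjugate of \<open>\<xi>\<close>. The class \<open>radial_bmo\<close> of
  functions with radial limits, an integrable radial majorant and a mean oscillation bound is visibly
  closed under linear combinations and contained in BMOA.
\<close>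

section \<open>Mean oscillation of the logarithm on the line\<close>

lemma set_integrable_const_Icc [simp]:
  fixes z :: "'a :: {banach, second_countable_topology}"
  shows "set_integrable lborel {a..b::real} (\<lambda>t. z)"
  unfolding set_integrable_def by (intro integrable_scaleR_left integrable_real_indicator) (auto simp: emeasure_lborel_Icc_eq)

text \<open>
  The comparison constant is the maximum of \<open>ln |t - p|\<close> over the interval, so that the deviation has
  a sign and its integral is an explicit value of the primitive \<open>x ln |x| - x\<close>.
\<close>
lemma log_distance_oscillation:
  fixes a b p :: real
  assumes "a < b"
  shows "set_integrable lborel {a..b} (\<lambda>t. ln \<bar>t - p\<bar>)"
    and "(LINT t:{a..b}|lborel. abs (ln \<bar>t - p\<bar> - ln (max \<bar>a - p\<bar> \<bar>b - p\<bar>))) \<le> 2 * (b - a)"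
proof -
  define M where "M = max \<bar>a - p\<bar> \<bar>b - p\<bar>"
  have M0: "M > 0" using assms by (auto simp: M_def max_def)
  define G where "G = (\<lambda>t. t * ln M - ((t - p) * ln \<bar>t - p\<bar> - (t - p)))"
  \<comment> \<open>\<^term>\<open>ln (0 :: real) = 0\<close> would spoil the sign of the integrand at the single point \<open>p\<close>.\<close>
  define g where "g = (\<lambda>t. if t = p then 0 else ln M - ln \<bar>t - p\<bar>)"
  have contx: "isCont (\<lambda>x::real. x * ln \<bar>x\<bar>) x" for x
  proof (cases "x = 0")
    case True
    have "((\<lambda>x::real. x * ln \<bar>x\<bar>) \<longlongrightarrow> 0) (at_right 0)" 
    proof (rule Lim_transform_eventually)
      show "((\<lambda>x::real. x * ln x) \<longlongrightarrow> 0) (at_right 0)" by real_asymp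
      show "\<forall>\<^sub>F x in at_right 0. x * ln x = x * ln \<bar>x::real\<bar>"
        by (auto simp: eventually_at_right_field intro: exI[of _ 1])
    qed
    moreover have "((\<lambda>x::real. x * ln \<bar>x\<bar>) \<longlongrightarrow> 0) (at_left 0)"
    proof (rule Lim_transform_eventually)
      show "((\<lambda>x::real. x * ln (-x)) \<longlongrightarrow> 0) (at_left 0)" by real_asymp
      show "\<forall>\<^sub>F x in at_left 0. x * ln (-x) = x * ln \<bar>x::real\<bar>"
        by (auto simp: eventually_at_left_field intro: exI[of _ "-1"])
    qed
    ultimately show ?thesis by (simp add: isCont_def True filterlim_split_at)
  next
    case False
    then show ?thesis by (auto intro!: continuous_intros)
  qed
  have contG: "continuous_on {a..b} G"
  proof -
    have "isCont (\<lambda>t. (\<lambda>x. x * ln \<bar>x\<bar>) (t - p)) t" for t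
      by (rule isCont_o2[OF _ contx]) (auto intro!: continuous_intros)
    then have "continuous_on {a..b} (\<lambda>t. (t - p) * ln \<bar>t - p\<bar>)"
      by (intro continuous_at_imp_continuous_on) simp
    moreover have "continuous_on {a..b} (\<lambda>t. t * ln M)" "continuous_on {a..b} (\<lambda>t. t - p)"
      by (intro continuous_intros)+
    ultimately show ?thesis unfolding G_def by (simp add: continuous_on_diff)
  qed
  define L where "L = (\<lambda>t. ln \<bar>t - p\<bar>)"
  have G_L: "G = (\<lambda>t. t * ln M - ((t - p) * L t - (t - p)))" by (simp add: G_def L_def)
  have "(g has_integral (G b - G a)) {a..b}"
  proof (rule fundamental_theorem_of_calculus_interior_strong[of "{p}"])
    fix t assume t: "t \<in> {a<..<b} - {p}"
    have "((\<lambda>x. ln \<bar>x - p\<bar>) has_real_derivative (1 / (t - p))) (at t)"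
    proof (cases "t > p")
      case True
      have "((\<lambda>x. ln (x - p)) has_real_derivative (1 / (t - p))) (at t)"
        using True by (auto intro!: derivative_eq_intros)
      moreover have "\<forall>\<^sub>F x in nhds t. ln \<bar>x - p\<bar> = ln (x - p)"
        using eventually_nhds_in_open[of "{p<..}" t] True by (auto elim!: eventually_mono)
      ultimately show ?thesis by (subst DERIV_cong_ev[OF refl _ refl]) auto
    next
      case False
      have "((\<lambda>x. ln (p - x)) has_real_derivative (1 / (t - p))) (at t)"
        using False t by (auto intro!: derivative_eq_intros simp: divide_simps)
      moreover have "\<forall>\<^sub>F x in nhds t. ln \<bar>x - p\<bar> = ln (p - x)"
        using eventually_nhds_in_open[of "{..<p}" t] False t by (auto elim!: eventually_mono)
      ultimately show ?thesis by (subst DERIV_cong_ev[OF refl _ refl]) auto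
    qed
    then have L: "(L has_real_derivative (1 / (t - p))) (at t)" by (simp add: L_def)
    have "(G has_real_derivative (ln M - (L t + (t - p) * (1 / (t - p)) - 1))) (at t)"
      unfolding G_L using t by (auto intro!: derivative_eq_intros L)
    also have "ln M - (L t + (t - p) * (1 / (t - p)) - 1) = g t"
      using t by (simp add: g_def L_def)
    finally have "(G has_real_derivative g t) (at t)" .
    then show "(G has_vector_derivative g t) (at t)"
      by (simp add: has_real_derivative_iff_has_vector_derivative)
  qed (use assms contG in auto)
  note int = this
  have gnn: "g t \<ge> 0" if "t \<in> {a..b}" for t
  proof (cases "t = p")
    case False
    have "\<bar>t - p\<bar> \<le> M" using that by (auto simp: M_def)
    then show ?thesis using False M0 by (auto simp: g_def ln_mono)
  qed (simp add: g_def)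
  have gm [measurable]: "g \<in> borel_measurable borel" unfolding g_def by measurable
  have "g absolutely_integrable_on {a..b}"
    using int gnn by (intro nonnegative_absolutely_integrable_1) auto
  then have gint: "set_integrable lborel {a..b} g"
    unfolding set_integrable_def by (subst (asm) integrable_completion) auto
  have "(LINT t:{a..b}|lborel. g t) = G b - G a"
    using set_borel_integral_eq_integral(2)[OF gint] int by (simp add: integral_unique)
  also have "\<dots> = (b - a) * ln M - ((b - p) * ln \<bar>b - p\<bar> - (a - p) * ln \<bar>a - p\<bar>) + (b - a)"
    by (simp add: G_def algebra_simps)
  also have "\<dots> = (b - p) * (ln M - ln \<bar>b - p\<bar>) - (a - p) * (ln M - ln \<bar>a - p\<bar>) + (b - a)"
    by (simp add: algebra_simps)
  also have "\<dots> \<le> 2 * (b - a)"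
  proof -
    \<comment> \<open>\<open>x log (M/x) \<le> M - x\<close>, by \<open>log y \<le> y - 1\<close>\<close>
    have *: "\<bar>x\<bar> * (ln M - ln \<bar>x\<bar>) \<le> M - \<bar>x\<bar>" "\<bar>x\<bar> * (ln M - ln \<bar>x\<bar>) \<ge> 0" if "\<bar>x\<bar> \<le> M" for x
    proof -
      show "\<bar>x\<bar> * (ln M - ln \<bar>x\<bar>) \<le> M - \<bar>x\<bar>"
      proof (cases "x = 0")
        case False
        have "ln M - ln \<bar>x\<bar> = ln (M / \<bar>x\<bar>)" using False M0 by (simp add: ln_div)
        also have "\<dots> \<le> M / \<bar>x\<bar> - 1" using False M0 by (intro ln_le_minus_one) auto
        finally have "\<bar>x\<bar> * (ln M - ln \<bar>x\<bar>) \<le> \<bar>x\<bar> * (M / \<bar>x\<bar> - 1)" by (intro mult_left_mono) auto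
        also have "\<dots> = M - \<bar>x\<bar>" using False by (simp add: algebra_simps)
        finally show ?thesis .
      qed (use M0 in auto)
      show "\<bar>x\<bar> * (ln M - ln \<bar>x\<bar>) \<ge> 0"
        using that by (cases "x = 0") (auto simp: ln_mono)
    qed
    have A: "\<bar>a - p\<bar> \<le> M" and B: "\<bar>b - p\<bar> \<le> M" by (auto simp: M_def)
    define u where "u = \<bar>a - p\<bar> * (ln M - ln \<bar>a - p\<bar>)"
    define v where "v = \<bar>b - p\<bar> * (ln M - ln \<bar>b - p\<bar>)"
    have u: "0 \<le> u" "u \<le> M - \<bar>a - p\<bar>" and v: "0 \<le> v" "v \<le> M - \<bar>b - p\<bar>"
      using *[OF A] *[OF B] by (auto simp: u_def v_def)
    have "(a - p) * (ln M - ln \<bar>a - p\<bar>) = (if a \<ge> p then u else - u)"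
      by (auto simp: u_def abs_if algebra_simps)
    moreover have "(b - p) * (ln M - ln \<bar>b - p\<bar>) = (if b \<ge> p then v else - v)"
      by (auto simp: v_def abs_if algebra_simps)
    moreover have "M = b - p \<and> b > p \<or> M = p - a \<and> a < p"
      using assms M0 unfolding M_def by linarith
    ultimately show ?thesis using u v assms by (auto split: if_splits)
  qed
  finally have bound: "(LINT t:{a..b}|lborel. g t) \<le> 2 * (b - a)" .
  have ae: "AE t in lborel. t \<noteq> p" using AE_lborel_singleton by auto
  have "(LINT t:{a..b}|lborel. abs (ln \<bar>t - p\<bar> - ln M)) = (LINT t:{a..b}|lborel. g t)"
    unfolding set_lebesgue_integral_def
  proof (rule integral_cong_AE)
    show "AE t in lborel. indicat_real {a..b} t *\<^sub>R abs (ln \<bar>t - p\<bar> - ln M) = indicat_real {a..b} t *\<^sub>R g t"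
      using ae
    proof eventually_elim
      case (elim t)
      then show ?case using gnn[of t] by (auto simp: indicator_def g_def)
    qed
  qed measurable
  with bound show "(LINT t:{a..b}|lborel. abs (ln \<bar>t - p\<bar> - ln (max \<bar>a - p\<bar> \<bar>b - p\<bar>))) \<le> 2 * (b - a)"
    by (simp add: M_def)
  have "set_integrable lborel {a..b} (\<lambda>t. ln M - g t)"
    using gint by (intro set_integral_diff) auto
  then show "set_integrable lborel {a..b} (\<lambda>t. ln \<bar>t - p\<bar>)"
    unfolding set_integrable_def
  proof (rule integrable_cong_AE_imp)
    show "AE t in lborel. indicat_real {a..b} t *\<^sub>R (ln M - g t) = indicat_real {a..b} t *\<^sub>R ln \<bar>t - p\<bar>"
      using ae by eventually_elim (auto simp: g_def)
  qed measurable
qed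

lemma norm_one_minus_cis: "norm (1 - cis s) = 2 * \<bar>sin (s / 2)\<bar>"
  using dist_exp_i_1[of s] by (simp add: cis_conv_exp norm_minus_commute)

lemma chord_upper: "norm (1 - cis s) \<le> \<bar>s\<bar>"
  using abs_sin_x_le_abs_x[of "s/2"] by (simp add: norm_one_minus_cis)

lemma chord_lower:
  assumes "\<bar>s\<bar> \<le> pi"
  shows "\<bar>s\<bar> / 4 \<le> norm (1 - cis s)"
proof -
  have pos: "s / 4 \<le> 2 * sin (s / 2)" if s: "0 \<le> s" "s \<le> pi" for s
  proof (cases "s \<le> 2 * pi / 3")
    case True
    show ?thesis
    proof (cases "s = 0")
      case False
      then obtain z where z: "z > 0" "z < s / 2" "sin (s / 2) - sin 0 = (s / 2 - 0) * cos z"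
        using MVT2[of 0 "s/2" sin cos] s by (auto intro: DERIV_sin)
      have "cos z \<ge> cos (pi / 3)" using z True by (intro cos_monotone_0_pi_le) auto
      then have "(s / 2) * cos z \<ge> (s / 2) * (1 / 2)" using s by (intro mult_left_mono) (auto simp: cos_60)
      moreover have "sin (s / 2) = s / 2 * cos z" using z by simp
      ultimately show ?thesis using s by linarith
    qed auto
  next
    case False
    have "sin (s / 2) \<ge> sin (pi / 6)" using False s by (intro sin_monotone_2pi_le) auto
    then show ?thesis using s pi_less_4 by (simp add: sin_30)
  qed
  show ?thesis
    using pos[of s] pos[of "-s"] assms by (cases "s \<ge> 0") (auto simp: norm_one_minus_cis)
qed

text \<open>
  The relevant distances are at most \<open>4 \<pi> < 13\<close>.
\<close>
lemma ln_le_3: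
  fixes x :: real
  assumes "0 < x" "x \<le> 13"
  shows "ln x \<le> 3"
proof -
  have e3: "exp 1 * exp 1 * exp (1::real) \<ge> 13"
  proof -
    have e: "exp (1::real) \<ge> 2.5" using e_approx_32 by (simp add: abs_if split: if_splits)
    have "exp 1 * exp 1 * exp (1::real) \<ge> 2.5 * 2.5 * 2.5" by (intro mult_mono e) auto
    then show ?thesis by simp
  qed
  then have "13 \<le> exp (3::real)" by (simp flip: exp_add)
  then show ?thesis 
    using assms by (metis order_trans ln_le_cancel_iff ln_exp exp_gt_zero)
qed

text \<open>
  An arc of length at most \<open>2 \<pi>\<close> can be moved by a period into \<open>[-2 \<pi>, 2 \<pi>]\<close>. On this interval
  \<open>ln |1 - e\<^sup>i\<^sup>s|\<close> has three singularities; up to a bounded error it is the sum of their logarithms.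
\<close>
lemma chord_three_logs:
  assumes s: "\<bar>s\<bar> \<le> 2 * pi" and ne: "s \<noteq> 0" "s \<noteq> 2 * pi" "s \<noteq> - 2 * pi"
  shows "abs (ln (norm (1 - cis s)) - (ln \<bar>s\<bar> + ln \<bar>s - 2 * pi\<bar> + ln \<bar>s + 2 * pi\<bar>)) \<le> 8"
proof -
  note ln13 = ln_le_3
  have "4 \<le> exp (2::real)"
    using exp_ge_add_one_self[of 1] mult_mono[of 2 "exp (1::real)" 2 "exp 1"] by (simp flip: exp_add)
  then have ln4: "ln 4 \<le> (2::real)"
    by (metis ln_le_cancel_iff ln_exp exp_gt_zero zero_less_numeral)
  have main: "ln \<bar>r\<bar> - 2 \<le> ln (norm (1 - cis r)) \<and> ln (norm (1 - cis r)) \<le> ln \<bar>r\<bar>"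
    if r: "\<bar>r\<bar> \<le> pi" "r \<noteq> 0" for r
  proof -
    have "ln (\<bar>r\<bar> / 4) \<le> ln (norm (1 - cis r))" "ln (norm (1 - cis r)) \<le> ln \<bar>r\<bar>"
      using chord_lower[OF r(1)] chord_upper[of r] r by (auto intro!: ln_mono)
    moreover have "ln (\<bar>r\<bar> / 4) = ln \<bar>r\<bar> - ln 4" using r by (simp add: ln_div)
    ultimately show ?thesis using ln4 by linarith
  qed
  have far: "0 \<le> ln \<bar>r\<bar> \<and> ln \<bar>r\<bar> \<le> 3" if "pi \<le> \<bar>r\<bar>" "\<bar>r\<bar> \<le> 4 * pi" for r
  proof -
    have "1 \<le> \<bar>r\<bar>" "\<bar>r\<bar> \<le> 13" using that pi_gt3 pi_approx by auto
    then show ?thesis using ln13 by auto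
  qed
  consider "\<bar>s\<bar> \<le> pi" | "s > pi" | "s < -pi" by linarith
  then show ?thesis
  proof cases
    case 1
    note A = main[OF 1 ne(1)]
    have "pi \<le> \<bar>s - 2 * pi\<bar>" "\<bar>s - 2 * pi\<bar> \<le> 4 * pi" using 1 s by linarith+
    note B = far[OF this]
    have "pi \<le> \<bar>s + 2 * pi\<bar>" "\<bar>s + 2 * pi\<bar> \<le> 4 * pi" using 1 s by linarith+
    note C = far[OF this]
    show ?thesis using A B C by (intro abs_leI) linarith+
  next
    case 2
    have eq: "cis s = cis (s - 2 * pi)" by (simp add: complex_eq_iff cos_diff sin_diff)
    have "\<bar>s - 2 * pi\<bar> \<le> pi" "s - 2 * pi \<noteq> 0" using 2 s ne pi_gt_zero by linarith+
    note A = main[OF this]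
    have "pi \<le> \<bar>s\<bar>" "\<bar>s\<bar> \<le> 4 * pi" using 2 s ne pi_gt_zero by linarith+
    note B = far[OF this]
    have "pi \<le> \<bar>s + 2 * pi\<bar>" "\<bar>s + 2 * pi\<bar> \<le> 4 * pi" using 2 s ne pi_gt_zero by linarith+
    note C = far[OF this]
    show ?thesis using A B C unfolding eq by (intro abs_leI) linarith+
  next
    case 3
    have eq: "cis s = cis (s + 2 * pi)" by (simp add: complex_eq_iff)
    have "\<bar>s + 2 * pi\<bar> \<le> pi" "s + 2 * pi \<noteq> 0" using 3 s ne pi_gt_zero by linarith+
    note A = main[OF this]
    have "pi \<le> \<bar>s\<bar>" "\<bar>s\<bar> \<le> 4 * pi" using 3 s ne pi_gt_zero by linarith+
    note B = far[OF this]
    have "pi \<le> \<bar>s - 2 * pi\<bar>" "\<bar>s - 2 * pi\<bar> \<le> 4 * pi" using 3 s ne pi_gt_zero by linarith+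
    note C = far[OF this]
    show ?thesis using A B C unfolding eq by (intro abs_leI) linarith+
  qed
qed

section \<open>The boundary kernel\<close>

text \<open>
  The mean may replace any other constant at the cost of a factor \<open>2\<close>.
\<close>
lemma mean_oscillation_le:
  fixes k :: "real \<Rightarrow> complex"
  assumes "a < b" and int [simp]: "set_integrable lborel {a..b} k"
    and osc: "(LINT t:{a..b}|lborel. norm (k t - c)) \<le> C * (b - a)"
  shows "(LINT t:{a..b}|lborel. norm (k t - (LINT s:{a..b}|lborel. k s) / of_real (b - a))) \<le> 2 * C * (b - a)"
proof -
  define z where "z = (LINT s:{a..b}|lborel. k s) / of_real (b - a)"
  have dint [simp]: "set_integrable lborel {a..b} (\<lambda>t. norm (k t - w))" for w
    by (intro set_integrable_norm set_integral_diff) auto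
  have "z - c = (LINT t:{a..b}|lborel. k t - c) / of_real (b - a)"
    using assms(1) by (simp add: z_def set_integral_const divide_simps scaleR_conv_of_real)
  then have "norm (z - c) * (b - a) = norm (LINT t:{a..b}|lborel. k t - c)"
    using assms(1) by (simp add: norm_divide flip: of_real_diff)
  also have "\<dots> \<le> (LINT t:{a..b}|lborel. norm (k t - c))"
    unfolding set_lebesgue_integral_def
    by (rule order_trans[OF integral_norm_bound]) (simp add: indicator_def)
  also note osc
  finally have zc: "norm (z - c) * (b - a) \<le> C * (b - a)" .
  have "(LINT t:{a..b}|lborel. norm (k t - z)) \<le> (LINT t:{a..b}|lborel. norm (k t - c) + norm (z - c))"
    by (rule set_integral_mono) (auto intro!: set_integral_add norm_triangle_ineq4[of "k _ - c" "z - c", simplified])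
  also have "\<dots> = (LINT t:{a..b}|lborel. norm (k t - c)) + norm (z - c) * (b - a)"
    using assms(1) by (simp add: set_integral_const mult.commute)
  also have "\<dots> \<le> 2 * C * (b - a)"
    using osc zc by argo
  finally show ?thesis by (simp add: z_def)
qed

text \<open>
  The bound on the comparison constant \<open>c\<close> depends on the interval but not on \<open>\<xi>\<close>; it gives the uniform
  \<open>L\<^sup>1\<close> bound that makes the kernel integrable on the product space.
\<close>
lemma log_chord_oscillation:
  fixes a b :: real and \<xi> :: complex
  assumes "norm \<xi> = 1" "a < b" "b \<le> a + 2 * pi"
  obtains c where "\<bar>c\<bar> \<le> 9 + 3 * \<bar>ln ((b - a) / 2)\<bar>"
    "set_integrable lborel {a..b} (\<lambda>t. ln (norm (1 - \<xi> * cis t)))"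
    "(LINT t:{a..b}|lborel. abs (ln (norm (1 - \<xi> * cis t)) - c)) \<le> 14 * (b - a)"
proof -
  define \<theta> where "\<theta> = Arg \<xi>"
  have \<xi>: "\<xi> = cis \<theta>" unfolding \<theta>_def using assms(1) by (subst cis_Arg) (auto simp: sgn_eq)
  \<comment> \<open>The singularity \<open>q\<close> nearest to the midpoint of the interval.\<close>
  define x where "x = (\<theta> + (a + b) / 2) / (2 * pi)"
  define q where "q = 2 * pi * real_of_int (round x) - \<theta>"
  have "\<bar>real_of_int (round x) - x\<bar> \<le> 1 / 2" by (rule of_int_round_abs_le)
  then have "\<bar>2 * pi * (real_of_int (round x) - x)\<bar> \<le> pi"
    by (simp add: abs_mult)
  moreover have "2 * pi * (real_of_int (round x) - x) = q - (a + b) / 2"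
    by (simp add: q_def x_def field_simps)
  ultimately have mid: "\<bar>q - (a + b) / 2\<bar> \<le> pi" by simp
  then have near: "\<bar>t - q\<bar> \<le> 2 * pi" if "t \<in> {a..b}" for t
    using that assms unfolding atLeastAtMost_iff by (simp add: abs_le_iff) argo
  have cis_eq: "\<xi> * cis t = cis (t - q)" for t
  proof -
    have "cis (2 * pi * real_of_int (round x)) = 1" by (rule cis_multiple_2pi) simp
    then have "cis (t - q) * 1 = cis (t - q) * cis (2 * pi * real_of_int (round x))" by simp
    also have "\<dots> = \<xi> * cis t" by (simp add: \<xi> cis_mult q_def algebra_simps)
    finally show ?thesis by simp
  qed
  define m :: "real \<Rightarrow> real" where "m = (\<lambda>p. ln (max \<bar>a - p\<bar> \<bar>b - p\<bar>))"
  define l :: "real \<Rightarrow> real \<Rightarrow> real" where "l = (\<lambda>p t. ln \<bar>t - p\<bar>)"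
  define c where "c = m q + m (q + 2 * pi) + m (q - 2 * pi)"
  define R where "R = (\<lambda>t. ln (norm (1 - \<xi> * cis t)) - (l q t + l (q + 2 * pi) t + l (q - 2 * pi) t))"
  have ae: "AE t in lborel. t \<noteq> q \<and> t \<noteq> q + 2 * pi \<and> t \<noteq> q - 2 * pi"
    using AE_lborel_singleton by auto
  have R8: "AE t in lborel. t \<in> {a..b} \<longrightarrow> \<bar>R t\<bar> \<le> 8"
    using ae
  proof eventually_elim
    case (elim t)
    show ?case
    proof
      assume "t \<in> {a..b}"
      from near[OF this] elim show "\<bar>R t\<bar> \<le> 8"
        using chord_three_logs[of "t - q"] by (auto simp: R_def cis_eq l_def algebra_simps)
    qed
  qed
  have m_bound: "\<bar>m p\<bar> \<le> 3 + \<bar>ln ((b - a) / 2)\<bar>" if "\<bar>p - q\<bar> \<le> 2 * pi" for p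
  proof -
    have le: "max \<bar>a - p\<bar> \<bar>b - p\<bar> \<le> 4 * pi" using near[of a] near[of b] that assms by auto
    have ge: "(b - a) / 2 \<le> max \<bar>a - p\<bar> \<bar>b - p\<bar>" by (simp add: max_def abs_if)
    have "ln ((b - a) / 2) \<le> m p" unfolding m_def using assms ge by (intro ln_mono) auto
    moreover have "m p \<le> 3"
      unfolding m_def using le ge assms pi_approx by (intro ln_le_3) auto
    ultimately show ?thesis by linarith
  qed
  have l_int [simp]: "set_integrable lborel {a..b} (l p)"
    and l_osc: "(LINT t:{a..b}|lborel. abs (l p t - m p)) \<le> 2 * (b - a)" for p
    using log_distance_oscillation[OF assms(2), of p] by (simp_all add: l_def m_def)
  have [measurable]: "l p \<in> borel_measurable borel" for p unfolding l_def by measurable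
  have [measurable]: "(\<lambda>t. cis t) \<in> borel_measurable borel"
    by (intro borel_measurable_continuous_onI continuous_intros)
  have [measurable]: "R \<in> borel_measurable borel" unfolding R_def by measurable
  have R_int: "set_integrable lborel {a..b} R"
    by (rule set_integrable_bound[of lborel "{a..b}" "\<lambda>_. 8::real"])
      (use R8 in \<open>auto simp: set_borel_measurable_def\<close>)
  have eq: "ln (norm (1 - \<xi> * cis t)) = R t + (l q t + l (q + 2 * pi) t + l (q - 2 * pi) t)" for t
    by (simp add: R_def)
  have int: "set_integrable lborel {a..b} (\<lambda>t. ln (norm (1 - \<xi> * cis t)))"
    unfolding eq by (intro set_integral_add R_int l_int)
  have dint [simp]: "set_integrable lborel {a..b} (\<lambda>t. abs (l p t - m p))" for p
    by (intro set_integrable_abs set_integral_diff) auto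
  have "(LINT t:{a..b}|lborel. abs (ln (norm (1 - \<xi> * cis t)) - c))
    \<le> (LINT t:{a..b}|lborel. 8 + (abs (l q t - m q) + (abs (l (q + 2 * pi) t - m (q + 2 * pi))
          + abs (l (q - 2 * pi) t - m (q - 2 * pi)))))"
    unfolding set_lebesgue_integral_def
  proof (rule integral_mono_AE')
    show "integrable lborel (\<lambda>t. indicator {a..b} t *\<^sub>R (8 + (abs (l q t - m q) + (abs (l (q + 2 * pi) t - m (q + 2 * pi))
          + abs (l (q - 2 * pi) t - m (q - 2 * pi))))))"
      unfolding set_integrable_def[symmetric] by (intro set_integral_add) auto
    show "AE t in lborel. indicat_real {a..b} t *\<^sub>R abs (ln (norm (1 - \<xi> * cis t)) - c)
       \<le> indicator {a..b} t *\<^sub>R (8 + (abs (l q t - m q) + (abs (l (q + 2 * pi) t - m (q + 2 * pi))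
          + abs (l (q - 2 * pi) t - m (q - 2 * pi)))))"
      using R8 by eventually_elim (auto simp: eq c_def indicator_def)
  qed (auto simp: indicator_def)
  also have "\<dots> = 8 * (b - a) + ((LINT t:{a..b}|lborel. abs (l q t - m q)) + ((LINT t:{a..b}|lborel. abs (l (q + 2 * pi) t - m (q + 2 * pi)))
          + (LINT t:{a..b}|lborel. abs (l (q - 2 * pi) t - m (q - 2 * pi)))))"
    using assms by (simp add: set_integral_add set_integral_const)
  also have "\<dots> \<le> 14 * (b - a)"
    using l_osc[of q] l_osc[of "q + 2 * pi"] l_osc[of "q - 2 * pi"] by argo
  finally show ?thesis
    using that[of c] int m_bound[of q] m_bound[of "q + 2 * pi"] m_bound[of "q - 2 * pi"] by (simp add: c_def)
qed

text \<open>
  The value of \<^const>\<open>Ln\<close> at \<open>0\<close> is unspecified, so \<open>0\<close> has to be excluded here and below.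
\<close>
lemma norm_Ln_bound:
  assumes "w \<noteq> 0"
  shows "norm (Ln w) \<le> \<bar>ln (norm w)\<bar> + 4"
proof -
  have "norm (Ln w) \<le> \<bar>Re (Ln w)\<bar> + \<bar>Im (Ln w)\<bar>" by (rule cmod_le)
  also have "\<dots> \<le> \<bar>ln (norm w)\<bar> + 4"
    using assms mpi_less_Im_Ln[of w] Im_Ln_le_pi[of w] pi_less_4 by auto
  finally show ?thesis .
qed

lemma kernel_zero_null:
  assumes "norm \<xi> = 1"
  shows "AE t in lborel. 1 - \<xi> * cis t \<noteq> 0"
proof -
  have sub: "{t. 1 - \<xi> * cis t = 0} \<subseteq> range (\<lambda>n. 2 * pi * of_int n - Arg \<xi>)"
  proof safe
    fix t assume "1 - \<xi> * cis t = 0"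
    moreover have "\<xi> = cis (Arg \<xi>)" using assms by (subst cis_Arg) (auto simp: sgn_eq)
    ultimately have "cis (Arg \<xi> + t) = 1" by (metis cis_mult eq_iff_diff_eq_0)
    then have "cos (Arg \<xi> + t) = 1" by (simp add: complex_eq_iff)
    then obtain n where "Arg \<xi> + t = of_int n * 2 * pi" using cos_one_2pi_int by blast
    then show "t \<in> range (\<lambda>n. 2 * pi * of_int n - Arg \<xi>)" by (intro image_eqI[of _ _ n]) (auto simp: algebra_simps)
  qed
  have "countable {t. 1 - \<xi> * cis t = 0}" by (rule countable_subset[OF sub]) auto
  then have "{t. 1 - \<xi> * cis t = 0} \<in> null_sets lborel" by (rule countable_imp_null_set_lborel)
  then show ?thesis by (auto dest: AE_not_in)
qed

lemma kernel_measurable [measurable]: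
  "(\<lambda>(\<xi>, t). Ln (1 - \<xi> * cis t)) \<in> borel_measurable (borel \<Otimes>\<^sub>M borel)"
proof -
  have [measurable]: "cis \<in> borel_measurable borel"
    by (intro borel_measurable_continuous_onI continuous_intros)
  show ?thesis by measurable
qed

text \<open>
  The oscillation is measured from the mean over the interval since, unlike an arbitrarily chosen
  constant, the mean depends measurably on \<open>\<xi>\<close>.
\<close>
lemma kernel_oscillation:
  fixes a b :: real and \<xi> :: complex
  assumes "norm \<xi> = 1" "a < b" "b \<le> a + 2 * pi"
  defines "k \<equiv> (\<lambda>t. Ln (1 - \<xi> * cis t))"
  shows "set_integrable lborel {a..b} k"
    and "(LINT t:{a..b}|lborel. norm (k t)) \<le> (27 + 3 * \<bar>ln ((b - a) / 2)\<bar>) * (b - a)"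
    and "(LINT t:{a..b}|lborel. norm (k t - (LINT s:{a..b}|lborel. k s) / of_real (b - a))) \<le> 36 * (b - a)"
proof -
  obtain c where c: "\<bar>c\<bar> \<le> 9 + 3 * \<bar>ln ((b - a) / 2)\<bar>"
    "set_integrable lborel {a..b} (\<lambda>t. ln (norm (1 - \<xi> * cis t)))"
    "(LINT t:{a..b}|lborel. abs (ln (norm (1 - \<xi> * cis t)) - c)) \<le> 14 * (b - a)"
    using log_chord_oscillation[OF assms(1-3)] .
  define d where "d = (\<lambda>t. abs (ln (norm (1 - \<xi> * cis t)) - c))"
  have [measurable]: "k \<in> borel_measurable borel" unfolding k_def by measurable
  have d_int: "set_integrable lborel {a..b} d"
    unfolding d_def by (intro set_integrable_abs set_integral_diff c) simp
  have ptw: "norm (k t - of_real c) \<le> d t + 4" if "1 - \<xi> * cis t \<noteq> 0" for t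
  proof -
    have "norm (k t - of_real c) \<le> \<bar>Re (k t - of_real c)\<bar> + \<bar>Im (k t - of_real c)\<bar>" by (rule cmod_le)
    also have "\<dots> \<le> d t + 4"
      using that mpi_less_Im_Ln[of "1 - \<xi> * cis t"] Im_Ln_le_pi[of "1 - \<xi> * cis t"] pi_less_4
      by (auto simp: k_def d_def)
    finally show ?thesis .
  qed
  have d4_int: "set_integrable lborel {a..b} (\<lambda>t. d t + x)" for x
    by (intro set_integral_add d_int) auto
  have d4: "(LINT t:{a..b}|lborel. d t + x) \<le> (14 + x) * (b - a)" for x
    using c(3) d_int assms(2) by (simp add: set_integral_const d_def ring_distribs)
  have ae: "AE t in lborel. t \<in> {a..b} \<longrightarrow> norm (k t - of_real c) \<le> d t + 4"
    using ptw kernel_zero_null[OF assms(1)] by eventually_elim (use ptw in auto)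
  have "set_integrable lborel {a..b} (\<lambda>t. k t - of_real c)"
    by (rule set_integrable_bound[OF d4_int[of 4]])
      (use ae in \<open>auto simp: set_borel_measurable_def elim!: eventually_mono\<close>)
  then have "set_integrable lborel {a..b} (\<lambda>t. (k t - of_real c) + of_real c)"
    by (intro set_integral_add) auto
  then show int: "set_integrable lborel {a..b} k" by simp
  have "(LINT t:{a..b}|lborel. norm (k t - of_real c)) \<le> (LINT t:{a..b}|lborel. d t + 4)"
    unfolding set_lebesgue_integral_def
  proof (rule integral_mono_AE')
    show "AE t in lborel. indicat_real {a..b} t *\<^sub>R norm (k t - of_real c) \<le> indicat_real {a..b} t *\<^sub>R (d t + 4)"
      using ae by eventually_elim (auto simp: indicator_def)
  qed (use d4_int[of 4] in \<open>auto simp: set_integrable_def indicator_def d_def\<close>)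
  also have "\<dots> \<le> 18 * (b - a)" using d4[of 4] by simp
  finally show "(LINT t:{a..b}|lborel. norm (k t - (LINT s:{a..b}|lborel. k s) / of_real (b - a))) \<le> 36 * (b - a)"
    using mean_oscillation_le[OF assms(2) int, of "of_real c" 18] by simp
  have "(LINT t:{a..b}|lborel. norm (k t)) \<le> (LINT t:{a..b}|lborel. d t + (4 + \<bar>c\<bar>))"
    unfolding set_lebesgue_integral_def
  proof (rule integral_mono_AE')
    show "AE t in lborel. indicat_real {a..b} t *\<^sub>R norm (k t) \<le> indicat_real {a..b} t *\<^sub>R (d t + (4 + \<bar>c\<bar>))"
      using ae
    proof eventually_elim
      case (elim t)
      then show ?case using norm_triangle_ineq[of "k t - of_real c" "of_real c"] by (auto simp: indicator_def)
    qed
  qed (use d4_int[of "4 + \<bar>c\<bar>"] in \<open>auto simp: set_integrable_def indicator_def d_def\<close>)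
  also have "\<dots> \<le> (14 + (4 + \<bar>c\<bar>)) * (b - a)" by (rule d4)
  also have "\<dots> \<le> (27 + 3 * \<bar>ln ((b - a) / 2)\<bar>) * (b - a)"
    using c(1) assms(2) by (intro mult_right_mono) auto
  finally show "(LINT t:{a..b}|lborel. norm (k t)) \<le> (27 + 3 * \<bar>ln ((b - a) / 2)\<bar>) * (b - a)" .
qed

section \<open>Functions with radial limits of bounded mean oscillation\<close>

text \<open>
  \<open>F\<close> is holomorphic in the disk and, in terms of the angle \<open>t\<close>, has almost everywhere the radial limit
  \<open>g t\<close>; \<open>H\<close> is an integrable majorant of \<open>F\<close> along almost every radius, and \<open>K\<close> bounds the
  mean oscillation of \<open>g\<close> on arcs, measured from some constant rather than from the mean.
\<close>
definition bmo_boundary ::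
  "(complex \<Rightarrow> complex) \<Rightarrow> (real \<Rightarrow> complex) \<Rightarrow> (real \<Rightarrow> real) \<Rightarrow> real \<Rightarrow> bool" where
  "bmo_boundary F g H K \<longleftrightarrow> F holomorphic_on ball 0 1 \<and>
    set_integrable lborel {0..2 * pi} H \<and>
    (AE t in lborel. (\<forall>r\<in>{0..<1}. norm (F (of_real r * cis t)) \<le> H t) \<and>
       ((\<lambda>r. F (of_real r * cis t)) \<longlongrightarrow> g t) (at_left 1)) \<and>
    (\<forall>a b. a < b \<longrightarrow> b \<le> a + 2 * pi \<longrightarrow> set_integrable lborel {a..b} g \<and>
       (\<exists>c. (LINT t:{a..b}|lborel. norm (g t - c)) \<le> K * (b - a)))"

text \<open>
  A convenient linear subspace of BMOA. Membership includes the almost everywhere existence of the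
  radial limits, so additivity of the boundary values needs no appeal to Fatou's theorem.
\<close>
definition radial_bmo :: "(complex \<Rightarrow> complex) \<Rightarrow> bool" where
  "radial_bmo F \<longleftrightarrow> (\<exists>g H K. bmo_boundary F g H K)"

lemma bmo_boundaryD:
  assumes "bmo_boundary F g H K"
  shows "F holomorphic_on ball 0 1" and "set_integrable lborel {0..2 * pi} H"
    and "AE t in lborel. (\<forall>r\<in>{0..<1}. norm (F (of_real r * cis t)) \<le> H t) \<and>
         ((\<lambda>r. F (of_real r * cis t)) \<longlongrightarrow> g t) (at_left 1)"
    and "a < b \<Longrightarrow> b \<le> a + 2 * pi \<Longrightarrow> set_integrable lborel {a..b} g"
    and "a < b \<Longrightarrow> b \<le> a + 2 * pi \<Longrightarrow>
         \<exists>c. (LINT t:{a..b}|lborel. norm (g t - c)) \<le> K * (b - a)"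
  using assms unfolding bmo_boundary_def by simp_all

lemma bmo_boundaryI:
  assumes "F holomorphic_on ball 0 1" and "set_integrable lborel {0..2 * pi} H"
    and "AE t in lborel. (\<forall>r\<in>{0..<1}. norm (F (of_real r * cis t)) \<le> H t) \<and>
         ((\<lambda>r. F (of_real r * cis t)) \<longlongrightarrow> g t) (at_left 1)"
    and "\<And>a b. a < b \<Longrightarrow> b \<le> a + 2 * pi \<Longrightarrow> set_integrable lborel {a..b} g"
    and "\<And>a b. a < b \<Longrightarrow> b \<le> a + 2 * pi \<Longrightarrow>
         \<exists>c. (LINT t:{a..b}|lborel. norm (g t - c)) \<le> K * (b - a)"
  shows "bmo_boundary F g H K"
  unfolding bmo_boundary_def using assms by simp

lemma radial_bmo_add:
  assumes "radial_bmo F" "radial_bmo G"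
  shows "radial_bmo (\<lambda>z. F z + G z)"
proof -
  obtain f H K where "bmo_boundary F f H K"
    using assms(1) by (auto simp: radial_bmo_def)
  note F = bmo_boundaryD[OF this]
  obtain g H' K' where "bmo_boundary G g H' K'"
    using assms(2) by (auto simp: radial_bmo_def)
  note G = bmo_boundaryD[OF this]
  have lim: "AE t in lborel. (\<forall>r\<in>{0..<1}. norm (F (of_real r * cis t) + G (of_real r * cis t)) \<le> H t + H' t) \<and>
         ((\<lambda>r. F (of_real r * cis t) + G (of_real r * cis t)) \<longlongrightarrow> f t + g t) (at_left 1)"
    using F(3) G(3) by eventually_elim (auto intro!: norm_triangle_mono tendsto_add)
  have osc: "\<exists>c. (LINT t:{a..b}|lborel. norm (f t + g t - c)) \<le> (K + K') * (b - a)"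
    if ab: "a < b" "b \<le> a + 2 * pi" for a b
  proof -
    obtain c where c: "(LINT t:{a..b}|lborel. norm (f t - c)) \<le> K * (b - a)" using F(5)[OF ab] by blast
    obtain d where d: "(LINT t:{a..b}|lborel. norm (g t - d)) \<le> K' * (b - a)" using G(5)[OF ab] by blast
    note int = F(4)[OF ab] G(4)[OF ab]
    have "(LINT t:{a..b}|lborel. norm (f t + g t - (c + d)))
      \<le> (LINT t:{a..b}|lborel. norm (f t - c) + norm (g t - d))"
    proof (rule set_integral_mono)
      show "norm (f t + g t - (c + d)) \<le> norm (f t - c) + norm (g t - d)" for t
        using norm_triangle_ineq[of "f t - c" "g t - d"] by (simp add: algebra_simps)
    qed (intro set_integrable_norm set_integral_diff set_integral_add int set_integrable_const_Icc)+
    also have "\<dots> = (LINT t:{a..b}|lborel. norm (f t - c)) + (LINT t:{a..b}|lborel. norm (g t - d))"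
      by (intro set_integral_add set_integrable_norm set_integral_diff int set_integrable_const_Icc)
    also have "\<dots> \<le> (K + K') * (b - a)" using c d by (simp add: ring_distribs)
    finally show ?thesis by blast
  qed
  have "bmo_boundary (\<lambda>z. F z + G z) (\<lambda>t. f t + g t) (\<lambda>t. H t + H' t) (K + K')"
    by (rule bmo_boundaryI[OF holomorphic_on_add[OF F(1) G(1)] set_integral_add(1)[OF F(2) G(2)] lim
          set_integral_add(1)[OF F(4) G(4)] osc])
  then show ?thesis by (auto simp: radial_bmo_def)
qed

lemma radial_bmo_cmult:
  assumes "radial_bmo F"
  shows "radial_bmo (\<lambda>z. w * F z)"
proof -
  obtain f H K where "bmo_boundary F f H K"
    using assms(1) by (auto simp: radial_bmo_def)
  note F = bmo_boundaryD[OF this]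
  have lim: "AE t in lborel. (\<forall>r\<in>{0..<1}. norm (w * F (of_real r * cis t)) \<le> norm w * H t) \<and>
         ((\<lambda>r. w * F (of_real r * cis t)) \<longlongrightarrow> w * f t) (at_left 1)"
    using F(3) by eventually_elim (auto intro!: mult_left_mono tendsto_intros simp: norm_mult)
  have osc: "\<exists>c. (LINT t:{a..b}|lborel. norm (w * f t - c)) \<le> (norm w * K) * (b - a)"
    if ab: "a < b" "b \<le> a + 2 * pi" for a b
  proof -
    obtain c where c: "(LINT t:{a..b}|lborel. norm (f t - c)) \<le> K * (b - a)" using F(5)[OF ab] by blast
    have "(LINT t:{a..b}|lborel. norm (w * f t - w * c)) = norm w * (LINT t:{a..b}|lborel. norm (f t - c))"
      by (simp add: norm_mult flip: right_diff_distrib)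
    also have "\<dots> \<le> (norm w * K) * (b - a)" using mult_left_mono[OF c, of "norm w"] by (simp add: mult.assoc)
    finally show ?thesis by blast
  qed
  have "bmo_boundary (\<lambda>z. w * F z) (\<lambda>t. w * f t) (\<lambda>t. norm w * H t) (norm w * K)"
    by (rule bmo_boundaryI[OF holomorphic_on_mult[OF holomorphic_on_const F(1)]
          set_integrable_mult_right[OF F(2)] lim set_integrable_mult_right[OF F(4)] osc])
  then show ?thesis by (auto simp: radial_bmo_def)
qed

text \<open>
  Integrals of \<^const>\<open>boundary_value\<close> are taken with respect to \<^const>\<open>lebesgue\<close>; the estimates
  are made for a Borel function equal to it almost everywhere.
\<close>
lemma set_integral_lebesgue_AE_eq:
  fixes g h :: "real \<Rightarrow> 'a :: euclidean_space"
  assumes int: "set_integrable lborel {a..b} g" and ae: "AE t in lborel. h t = g t"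
  shows "set_integrable lebesgue {a..b} h"
    and "(LINT t:{a..b}|lebesgue. h t) = (LINT t:{a..b}|lborel. g t)"
proof -
  have meas: "(\<lambda>t. indicator {a..b} t *\<^sub>R g t) \<in> borel_measurable lborel"
    using int unfolding set_integrable_def by (rule borel_measurable_integrable)
  have g_int: "set_integrable lebesgue {a..b} g"
    using int meas unfolding set_integrable_def by (subst integrable_completion) auto
  obtain N where N: "{t \<in> space lborel. h t \<noteq> g t} \<subseteq> N" "N \<in> null_sets lborel"
    using ae by (auto simp: eventually_ae_filter)
  have neg: "negligible N"
    using N(2) by (simp add: negligible_iff_null_sets null_sets_completionI)
  show h_int: "set_integrable lebesgue {a..b} h"
    by (rule absolutely_integrable_spike[OF g_int neg]) (use N in auto)
  have "(LINT t:{a..b}|lebesgue. h t) = (LINT t:{a..b}|lebesgue. g t)"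
    unfolding set_lebesgue_integral_def
  proof (rule integral_cong_AE)
    show "AE t in lebesgue. indicat_real {a..b} t *\<^sub>R h t = indicat_real {a..b} t *\<^sub>R g t"
      using AE_completion[OF ae] by eventually_elim simp
  qed (use h_int g_int in \<open>auto simp: set_integrable_def dest: borel_measurable_integrable\<close>)
  also have "\<dots> = (LINT t:{a..b}|lborel. g t)"
    unfolding set_lebesgue_integral_def using meas by (rule integral_completion)
  finally show "(LINT t:{a..b}|lebesgue. h t) = (LINT t:{a..b}|lborel. g t)" .
qed

lemma radial_bmo_in_BMOA:
  assumes "radial_bmo F" and fF: "\<And>z. z \<in> ball 0 1 \<Longrightarrow> f z = F z"
  shows "f \<in> BMOA"
proof -
  obtain g H K where "bmo_boundary F g H K"
    using assms(1) by (auto simp: radial_bmo_def)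
  note F = bmo_boundaryD[OF this]
  have hol: "f holomorphic_on ball 0 1"
    by (rule holomorphic_transform[OF F(1)]) (simp add: fF)
  have fr: "f (of_real r * cis t) = F (of_real r * cis t)" if "r \<in> {0..<1}" for r t
    using that by (intro fF) (auto simp: norm_mult)
  have "f \<in> hardy_H1"
    unfolding hardy_H1_def
  proof (intro CollectI conjI hol bdd_aboveI2)
    fix r :: real assume r: "r \<in> {0..<1}"
    have "(LINT t:{0..2 * pi}|lebesgue. norm (f (of_real r * cis t))) \<le> (LINT t:{0..2 * pi}|lebesgue. H t)"
      unfolding set_lebesgue_integral_def
    proof (rule integral_mono_AE')
      show "integrable lebesgue (\<lambda>t. indicat_real {0..2 * pi} t *\<^sub>R H t)"
        using set_integral_lebesgue_AE_eq(1)[OF F(2)] by (simp add: set_integrable_def)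
      show "AE t in lebesgue. indicat_real {0..2 * pi} t *\<^sub>R norm (f (of_real r * cis t)) \<le> indicat_real {0..2 * pi} t *\<^sub>R H t"
        using AE_completion[OF F(3)] by eventually_elim (use r fr in \<open>auto simp: indicator_def\<close>)
      show "AE t in lebesgue. 0 \<le> indicat_real {0..2 * pi} t *\<^sub>R H t"
        using AE_completion[OF F(3)]
      proof eventually_elim
        case (elim t)
        then have "norm (F (of_real r * cis t)) \<le> H t" using r by blast
        then have "0 \<le> H t" by (rule order_trans[OF norm_ge_zero])
        then show ?case by simp
      qed
    qed
    then show "1 / (2 * pi) * (LINT t:{0..2 * pi}|lebesgue. norm (f (of_real r * cis t)))
      \<le> 1 / (2 * pi) * (LINT t:{0..2 * pi}|lebesgue. H t)"
      by (intro mult_left_mono) auto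
  qed
  moreover have bv: "AE t in lborel. boundary_value f (cis t) = g t"
    using F(3)
  proof eventually_elim
    case (elim t)
    have "\<forall>\<^sub>F r in at_left (1::real). F (of_real r * cis t) = f (of_real r * cis t)"
      using eventually_at_left_real[OF zero_less_one] by eventually_elim (auto simp: fr)
    then have "((\<lambda>r. f (of_real r * cis t)) \<longlongrightarrow> g t) (at_left 1)"
      by (rule Lim_transform_eventually[OF conjunct2[OF elim]])
    then show ?case unfolding boundary_value_def by (intro tendsto_Lim) auto
  qed
  have "boundary_value f \<in> BMO_circle"
    unfolding BMO_circle_def
  proof (intro CollectI conjI exI allI impI)
    show "set_integrable lebesgue {0..2 * pi} (\<lambda>t. boundary_value f (cis t))"
      by (rule set_integral_lebesgue_AE_eq(1)[OF F(4) bv]) auto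
    fix a b :: real assume ab: "a < b \<and> b \<le> a + 2 * pi"
    then have int: "set_integrable lborel {a..b} g" using F(4) by blast
    have mean: "arc_mean (boundary_value f) a b = (LINT t:{a..b}|lborel. g t) / of_real (b - a)" (is "_ = ?c")
      unfolding arc_mean_def by (simp add: set_integral_lebesgue_AE_eq(2)[OF int bv])
    have "set_integrable lborel {a..b} (\<lambda>t. norm (g t - ?c))"
      by (intro set_integrable_norm set_integral_diff int set_integrable_const_Icc)
    moreover have "AE t in lborel. norm (boundary_value f (cis t) - ?c) = norm (g t - ?c)"
      using bv by eventually_elim simp
    ultimately have "(LINT t:{a..b}|lebesgue. norm (boundary_value f (cis t) - ?c))
        = (LINT t:{a..b}|lborel. norm (g t - ?c))"
      by (rule set_integral_lebesgue_AE_eq(2))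
    also obtain c where "(LINT t:{a..b}|lborel. norm (g t - c)) \<le> K * (b - a)"
      using F(5) ab by blast
    then have "(LINT t:{a..b}|lborel. norm (g t - ?c)) \<le> 2 * K * (b - a)"
      using mean_oscillation_le[OF _ int] ab by blast
    finally show "1 / (b - a) * (LINT t:{a..b}|lebesgue. norm (boundary_value f (cis t) - arc_mean (boundary_value f) a b)) \<le> 2 * K"
      unfolding mean using ab by (simp add: divide_simps)
  qed
  ultimately show ?thesis by (simp add: BMOA_def)
qed

section \<open>Logarithmic potentials of positive measures on the circle\<close>

text \<open>
  The estimate rests on \<open>|1 - w| \<le> 2 |1 - r w|\<close>.
\<close>
lemma radial_kernel_bound:
  assumes w: "norm w = 1" "w \<noteq> 1" and r: "0 \<le> r" "r < 1"
  shows "norm (Ln (1 - of_real r * w)) \<le> norm (Ln (1 - w)) + 5"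
proof -
  have rw: "norm (of_real r * w) = r" using w r by (simp add: norm_mult)
  have lower: "1 - r \<le> norm (1 - of_real r * w)"
    using norm_triangle_ineq2[of 1 "of_real r * w"] rw by simp
  have "1 - w = (1 - of_real r * w) - of_real (1 - r) * w" by (simp add: algebra_simps)
  then have "norm (1 - w) \<le> norm (1 - of_real r * w) + norm (of_real (1 - r) * w)"
    by (metis norm_triangle_ineq4)
  also have "norm (of_real (1 - r) * w) = 1 - r" using w r by (simp add: norm_mult del: of_real_diff)
  finally have half: "norm (1 - w) / 2 \<le> norm (1 - of_real r * w)" using lower by simp
  have upper: "norm (1 - of_real r * w) \<le> 2"
    using norm_triangle_ineq4[of 1 "of_real r * w"] rw r by simp
  have pos: "0 < norm (1 - w)" using w by auto
  then have pos': "0 < norm (1 - of_real r * w)" using half by linarith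
  have ln2: "ln (2::real) \<le> 1" using ln_le_minus_one[of 2] by simp
  have "ln (norm (1 - of_real r * w)) \<le> 1"
    using ln_mono[OF upper pos'] ln2 by simp
  moreover have "ln (norm (1 - w)) - 1 \<le> ln (norm (1 - of_real r * w))"
    using ln_mono[OF half] pos ln2 by (simp add: ln_div)
  moreover have "\<bar>ln (norm (1 - w))\<bar> \<le> norm (Ln (1 - w))"
    using abs_Re_le_cmod[of "Ln (1 - w)"] pos by simp
  ultimately have "\<bar>ln (norm (1 - of_real r * w))\<bar> \<le> norm (Ln (1 - w)) + 1"
    by linarith
  moreover have "norm (Ln (1 - of_real r * w)) \<le> \<bar>ln (norm (1 - of_real r * w))\<bar> + 4"
    using pos' by (intro norm_Ln_bound) auto
  ultimately show ?thesis by linarith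
qed

text \<open>
  The analytic logarithmic potential \<open>\<integral> log (1 - \<xi> z) dm(\<xi>)\<close> of a measure on the circle.
\<close>
definition log_potential :: "complex measure \<Rightarrow> complex \<Rightarrow> complex" where
  "log_potential m z = (\<integral>\<xi>. Ln (1 - \<xi> * z) \<partial>m)"

text \<open>
  A finite positive measure on the circle, encoded as a Borel measure on the plane that is
  concentrated on the circle.
\<close>
locale circle_measure = finite_measure m for m :: "complex measure" +
  assumes sets_m [measurable_cong]: "sets m = sets borel"
    and AE_circle: "AE \<xi> in m. norm \<xi> = 1"
begin

sublocale P: pair_sigma_finite m lborel ..

lemma potential_integrable:
  assumes "norm z < 1"
  shows "integrable m (\<lambda>\<xi>. Ln (1 - \<xi> * z))"
proof -
  have ge: "1 - norm z \<le> norm (1 - \<xi> * z)" if "norm \<xi> = 1" for \<xi>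
    using norm_triangle_ineq2[of 1 "\<xi> * z"] that by (simp add: norm_mult)
  have le: "norm (1 - \<xi> * z) \<le> 2" if "norm \<xi> = 1" for \<xi>
    using norm_triangle_ineq4[of 1 "\<xi> * z"] that assms by (simp add: norm_mult)
  show ?thesis
  proof (rule integrable_const_bound[where B = "\<bar>ln (1 - norm z)\<bar> + \<bar>ln 2\<bar> + 4"])
    show "AE \<xi> in m. norm (Ln (1 - \<xi> * z)) \<le> \<bar>ln (1 - norm z)\<bar> + \<bar>ln 2\<bar> + 4"
      using AE_circle
    proof eventually_elim
      case (elim \<xi>)
      have p: "0 < norm (1 - \<xi> * z)" using ge[OF elim] assms by linarith
      have "ln (1 - norm z) \<le> ln (norm (1 - \<xi> * z))" "ln (norm (1 - \<xi> * z)) \<le> ln 2"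
        using ge[OF elim] le[OF elim] assms p by (auto intro!: ln_mono)
      moreover have "norm (Ln (1 - \<xi> * z)) \<le> \<bar>ln (norm (1 - \<xi> * z))\<bar> + 4"
        using p by (intro norm_Ln_bound) auto
      ultimately show ?case by linarith
    qed
  qed measurable
qed

text \<open>
  The potential is the sum of the power series whose coefficients are the moments of \<open>m\<close> divided by
  \<open>- n\<close>; the term \<open>n = 0\<close> vanishes by the convention \<open>x / 0 = 0\<close>.
\<close>
lemma potential_holomorphic: "log_potential m holomorphic_on ball 0 1"
proof (rule power_series_holomorphic[where a = "\<lambda>n. \<integral>\<xi>. - (\<xi> ^ n / of_nat n) \<partial>m"])
  fix z :: complex assume "z \<in> ball 0 1"
  then have z: "norm z < 1" by simp
  define f where "f = (\<lambda>n \<xi>. - (\<xi> ^ n / of_nat n) * z ^ n)"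
  have [measurable]: "f n \<in> borel_measurable m" for n unfolding f_def by measurable
  have le: "norm (f n \<xi>) \<le> norm z ^ n" if "norm \<xi> = 1" for n \<xi>
  proof (cases "n = 0")
    case False
    then have "norm z ^ n / real n \<le> norm z ^ n / 1" by (intro divide_left_mono) auto
    then show ?thesis using that by (simp add: f_def norm_mult norm_divide norm_power)
  qed (simp add: f_def)
  have sm: "summable (\<lambda>n. norm z ^ n)" using z by (simp add: summable_geometric)
  have ae_le: "AE \<xi> in m. norm (f n \<xi>) \<le> norm z ^ n" for n
    using AE_circle by eventually_elim (rule le)
  have int: "integrable m (f n)" for n
    by (rule integrable_const_bound[OF ae_le]) measurable
  have "(\<lambda>n. integral\<^sup>L m (f n)) sums (\<integral>\<xi>. (\<Sum>n. f n \<xi>) \<partial>m)"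
  proof (rule sums_integral[OF int])
    show "AE \<xi> in m. summable (\<lambda>n. norm (f n \<xi>))"
      using AE_circle by eventually_elim (rule summable_comparison_test'[OF sm], simp add: le)
    have "norm (\<integral>\<xi>. norm (f n \<xi>) \<partial>m) \<le> norm z ^ n * measure m (space m)" for n
    proof -
      have "(\<integral>\<xi>. norm (f n \<xi>) \<partial>m) \<le> (\<integral>\<xi>. norm z ^ n \<partial>m)"
        using ae_le int by (intro integral_mono_AE) auto
      then show ?thesis by (simp add: mult.commute)
    qed
    then show "summable (\<lambda>n. \<integral>\<xi>. norm (f n \<xi>) \<partial>m)"
      by (rule summable_comparison_test'[OF summable_mult2[OF sm]])
  qed
  moreover have "(\<integral>\<xi>. (\<Sum>n. f n \<xi>) \<partial>m) = log_potential m z"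
    unfolding log_potential_def
  proof (rule integral_cong_AE)
    show "AE \<xi> in m. (\<Sum>n. f n \<xi>) = Ln (1 - \<xi> * z)"
      using AE_circle
    proof eventually_elim
      case (elim \<xi>)
      then have "(\<lambda>n. - ((- (- (\<xi> * z))) ^ n) / of_nat n) sums ln (1 + - (\<xi> * z))"
        using z by (intro Ln_series') (simp add: norm_mult)
      then have "(\<lambda>n. f n \<xi>) sums Ln (1 - \<xi> * z)" by (simp add: f_def power_mult_distrib)
      then show ?case by (simp add: sums_iff)
    qed
  qed measurable
  moreover have "integral\<^sup>L m (f n) = (\<integral>\<xi>. - (\<xi> ^ n / of_nat n) \<partial>m) * z ^ n" for n
    unfolding f_def by simp
  ultimately show "(\<lambda>n. (\<integral>\<xi>. - (\<xi> ^ n / of_nat n) \<partial>m) * (z - 0) ^ n) sums log_potential m z"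
    by simp
qed

lemma kernel_measurable_sections [measurable]: "(\<lambda>t. Ln (1 - \<xi> * cis t)) \<in> borel_measurable borel"
  "(\<lambda>\<xi>. Ln (1 - \<xi> * cis t)) \<in> borel_measurable borel"
  using measurable_Pair_compose_split[OF kernel_measurable, of "\<lambda>_. \<xi>" borel "\<lambda>t. t"]
    measurable_Pair_compose_split[OF kernel_measurable, of "\<lambda>t. t" borel "\<lambda>_. t"] by simp_all

lemma kernel_integrable_product:
  assumes ab: "a < b" "b \<le> a + 2 * pi"
  shows "integrable (m \<Otimes>\<^sub>M lborel) (\<lambda>(\<xi>, t). indicator {a..b} t *\<^sub>R Ln (1 - \<xi> * cis t))"
proof (rule P.Fubini_integrable)
  show meas: "(\<lambda>(\<xi>, t). indicator {a..b} t *\<^sub>R Ln (1 - \<xi> * cis t)) \<in> borel_measurable (m \<Otimes>\<^sub>M lborel)"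
    by measurable
  show "AE \<xi> in m. integrable lborel (\<lambda>t. case (\<xi>, t) of (\<xi>, t) \<Rightarrow> indicator {a..b} t *\<^sub>R Ln (1 - \<xi> * cis t))"
    using AE_circle by eventually_elim (use kernel_oscillation(1)[OF _ ab] in \<open>simp add: set_integrable_def\<close>)
  show "integrable m (\<lambda>\<xi>. \<integral>t. norm (case (\<xi>, t) of (\<xi>, t) \<Rightarrow> indicator {a..b} t *\<^sub>R Ln (1 - \<xi> * cis t)) \<partial>lborel)"
  proof (rule integrable_const_bound[where B = "(27 + 3 * \<bar>ln ((b - a) / 2)\<bar>) * (b - a)"])
    show "AE \<xi> in m. norm (\<integral>t. norm (case (\<xi>, t) of (\<xi>, t) \<Rightarrow> indicator {a..b} t *\<^sub>R Ln (1 - \<xi> * cis t)) \<partial>lborel)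
       \<le> (27 + 3 * \<bar>ln ((b - a) / 2)\<bar>) * (b - a)"
      using AE_circle
    proof eventually_elim
      case (elim \<xi>)
      then show ?case using kernel_oscillation(2)[OF elim ab]
        by (simp add: set_lebesgue_integral_def)
    qed
  qed (use meas in measurable)
qed

lemma AE_kernel_integrable: "AE t in lborel. integrable m (\<lambda>\<xi>. Ln (1 - \<xi> * cis t))"
proof -
  have "AE t in lborel. \<forall>n::int. integrable m (\<lambda>\<xi>. indicator {of_int n..of_int n + 1} t *\<^sub>R Ln (1 - \<xi> * cis t))"
    unfolding AE_all_countable
  proof
    fix n :: int
    have "real_of_int n + 1 \<le> real_of_int n + 2 * pi" using pi_gt3 by simp
    from P.AE_integrable_snd[OF kernel_integrable_product[OF _ this]]
    show "AE t in lborel. integrable m (\<lambda>\<xi>. indicator {of_int n..of_int n + 1} t *\<^sub>R Ln (1 - \<xi> * cis t))"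
      by simp
  qed
  then show ?thesis
  proof eventually_elim
    case (elim t)
    have "t \<in> {of_int \<lfloor>t\<rfloor>..of_int \<lfloor>t\<rfloor> + 1}" by (auto simp: less_imp_le)
    with elim[rule_format, of "\<lfloor>t\<rfloor>"] show ?case by simp
  qed
qed

lemma AE_kernel_regular: "AE t in lborel. AE \<xi> in m. 1 - \<xi> * cis t \<noteq> 0"
proof -
  have [measurable]: "cis \<in> borel_measurable borel"
    by (intro borel_measurable_continuous_onI continuous_intros)
  have "AE \<xi> in m. AE t in lborel. 1 - \<xi> * cis t \<noteq> 0"
    using AE_circle by eventually_elim (rule kernel_zero_null)
  then show ?thesis by (subst (asm) P.AE_commute) measurable
qed

text \<open>
  The boundary function of the potential, as a function of the angle. Where the kernel is not
  integrable the integral has the default value \<open>0\<close>, which concerns only a null set of angles.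
\<close>
definition boundary_potential :: "real \<Rightarrow> complex" where
  "boundary_potential t = (\<integral>\<xi>. Ln (1 - \<xi> * cis t) \<partial>m)"

lemma radial_limit:
  assumes int: "integrable m (\<lambda>\<xi>. Ln (1 - \<xi> * cis t))" and reg: "AE \<xi> in m. 1 - \<xi> * cis t \<noteq> 0"
  shows "r \<in> {0..<1} \<Longrightarrow> norm (log_potential m (of_real r * cis t)) \<le> (\<integral>\<xi>. norm (Ln (1 - \<xi> * cis t)) + 5 \<partial>m)"
    and "((\<lambda>r. log_potential m (of_real r * cis t)) \<longlongrightarrow> boundary_potential t) (at_left 1)"
proof -
  have dom_int: "integrable m (\<lambda>\<xi>. norm (Ln (1 - \<xi> * cis t)) + 5)" using int by simp
  have dom: "AE \<xi> in m. norm (Ln (1 - \<xi> * (of_real r * cis t))) \<le> norm (Ln (1 - \<xi> * cis t)) + 5"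
    if "0 \<le> r" "r < 1" for r
    using AE_circle reg
  proof eventually_elim
    case (elim \<xi>)
    then show ?case using radial_kernel_bound[of "\<xi> * cis t" r] that
      by (simp add: norm_mult mult.left_commute)
  qed
  show "norm (log_potential m (of_real r * cis t)) \<le> (\<integral>\<xi>. norm (Ln (1 - \<xi> * cis t)) + 5 \<partial>m)"
    if "r \<in> {0..<1}"
    unfolding log_potential_def
    by (rule order_trans[OF integral_norm_bound], rule integral_mono_AE'[OF dom_int])
      (use dom[of r] that in auto)
  show "((\<lambda>r. log_potential m (of_real r * cis t)) \<longlongrightarrow> boundary_potential t) (at_left 1)"
  proof (rule tendsto_at_left_sequentially[of 0])
    fix S :: "nat \<Rightarrow> real" assume S: "\<And>n. S n < 1" "\<And>n. 0 < S n" "S \<longlonglongrightarrow> 1"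
    show "(\<lambda>n. log_potential m (of_real (S n) * cis t)) \<longlonglongrightarrow> boundary_potential t"
      unfolding log_potential_def boundary_potential_def
    proof (rule integral_dominated_convergence[OF _ _ dom_int])
      show "AE \<xi> in m. norm (Ln (1 - \<xi> * (of_real (S n) * cis t))) \<le> norm (Ln (1 - \<xi> * cis t)) + 5" for n
        using dom[of "S n"] S by (simp add: less_imp_le)
      show "AE \<xi> in m. (\<lambda>n. Ln (1 - \<xi> * (of_real (S n) * cis t))) \<longlonglongrightarrow> Ln (1 - \<xi> * cis t)"
        using AE_circle reg
      proof eventually_elim
        case (elim \<xi>)
        have "Re (1 - \<xi> * cis t) > 0"
        proof -
          have n1: "norm (\<xi> * cis t) = 1" using elim by (simp add: norm_mult)
          have "Re (\<xi> * cis t) \<noteq> 1"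
          proof
            assume re: "Re (\<xi> * cis t) = 1"
            then have "Im (\<xi> * cis t) = 0" using n1 cmod_power2[of "\<xi> * cis t"] by simp
            with re elim(2) show False by (simp add: complex_eq_iff)
          qed
          moreover have "Re (\<xi> * cis t) \<le> 1" using complex_Re_le_cmod[of "\<xi> * cis t"] n1 by simp
          ultimately show ?thesis by simp
        qed
        then have "1 - \<xi> * cis t \<notin> \<real>\<^sub>\<le>\<^sub>0" by (auto simp: complex_nonpos_Reals_iff)
        moreover have "(\<lambda>n. 1 - \<xi> * (of_real (S n) * cis t)) \<longlonglongrightarrow> 1 - \<xi> * (of_real 1 * cis t)"
          by (intro tendsto_intros S(3))
        ultimately show ?case by (intro tendsto_Ln) simp_all
      qed
    qed measurable
  qed simp
qed

lemma boundary_potential_oscillation: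
  assumes ab: "a < b" "b \<le> a + 2 * pi"
  shows "\<exists>c. (LINT t:{a..b}|lborel. norm (boundary_potential t - c)) \<le> 36 * measure m (space m) * (b - a)"
proof -
  define M where "M = (\<lambda>\<xi>. (LINT s:{a..b}|lborel. Ln (1 - \<xi> * cis s)) / of_real (b - a))"
  define \<psi> where "\<psi> = (\<lambda>\<xi> t. indicat_real {a..b} t * norm (Ln (1 - \<xi> * cis t) - M \<xi>))"
  have M_int: "integrable m M"
    using P.integrable_fst[OF kernel_integrable_product[OF ab]]
    unfolding M_def set_lebesgue_integral_def by simp
  have [measurable]: "M \<in> borel_measurable m" using M_int by simp
  have meas: "case_prod \<psi> \<in> borel_measurable (m \<Otimes>\<^sub>M lborel)" unfolding \<psi>_def by measurable
  have \<psi>_int1: "AE \<xi> in m. integrable lborel (\<psi> \<xi>)"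
    using AE_circle
  proof eventually_elim
    case (elim \<xi>)
    have "set_integrable lborel {a..b} (\<lambda>t. norm (Ln (1 - \<xi> * cis t) - M \<xi>))"
      by (intro set_integrable_norm set_integral_diff kernel_oscillation(1)[OF elim ab] set_integrable_const_Icc)
    then show ?case by (simp add: set_integrable_def \<psi>_def)
  qed
  have \<psi>_le: "AE \<xi> in m. (\<integral>t. \<psi> \<xi> t \<partial>lborel) \<le> 36 * (b - a)"
    using AE_circle
  proof eventually_elim
    case (elim \<xi>)
    show ?case using kernel_oscillation(3)[OF elim ab]
      by (simp add: set_lebesgue_integral_def \<psi>_def M_def)
  qed
  have nn: "0 \<le> \<psi> \<xi> t" for \<xi> t by (simp add: \<psi>_def)
  have \<psi>_int2: "integrable m (\<lambda>\<xi>. \<integral>t. \<psi> \<xi> t \<partial>lborel)"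
  proof (rule integrable_const_bound[where B = "36 * (b - a)"])
    show "AE \<xi> in m. norm (\<integral>t. \<psi> \<xi> t \<partial>lborel) \<le> 36 * (b - a)"
      using \<psi>_le by eventually_elim (simp add: nn integral_nonneg_AE)
  qed (use meas in measurable)
  have \<psi>_int: "integrable (m \<Otimes>\<^sub>M lborel) (case_prod \<psi>)"
    using meas \<psi>_int1 \<psi>_int2 nn by (intro P.Fubini_integrable) simp_all
  \<comment> \<open>The constant compared with is the average of the means \<open>M\<close>.\<close>
  have "(LINT t:{a..b}|lborel. norm (boundary_potential t - (\<integral>\<xi>. M \<xi> \<partial>m))) \<le> (\<integral>t. (\<integral>\<xi>. \<psi> \<xi> t \<partial>m) \<partial>lborel)"
    unfolding set_lebesgue_integral_def
  proof (rule integral_mono_AE')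
    show "integrable lborel (\<lambda>t. \<integral>\<xi>. \<psi> \<xi> t \<partial>m)" by (rule P.integrable_snd[OF \<psi>_int])
    show "AE t in lborel. indicat_real {a..b} t *\<^sub>R norm (boundary_potential t - (\<integral>\<xi>. M \<xi> \<partial>m)) \<le> (\<integral>\<xi>. \<psi> \<xi> t \<partial>m)"
      using AE_kernel_integrable
    proof eventually_elim
      case (elim t)
      have "boundary_potential t - (\<integral>\<xi>. M \<xi> \<partial>m) = (\<integral>\<xi>. Ln (1 - \<xi> * cis t) - M \<xi> \<partial>m)"
        unfolding boundary_potential_def using elim M_int by simp
      also have "norm \<dots> \<le> (\<integral>\<xi>. norm (Ln (1 - \<xi> * cis t) - M \<xi>) \<partial>m)" by (rule integral_norm_bound)
      finally show ?case by (simp add: \<psi>_def mult_left_mono)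
    qed
  qed (simp add: nn)
  also have "\<dots> = (\<integral>\<xi>. (\<integral>t. \<psi> \<xi> t \<partial>lborel) \<partial>m)" by (rule P.Fubini_integral[OF \<psi>_int])
  also have "\<dots> \<le> (\<integral>\<xi>. 36 * (b - a) \<partial>m)"
    by (rule integral_mono_AE[OF \<psi>_int2 _ \<psi>_le]) simp
  also have "\<dots> = 36 * measure m (space m) * (b - a)" by simp
  finally show ?thesis by blast
qed

lemma radial_bmo_log_potential: "radial_bmo (log_potential m)"
proof -
  define H where "H = (\<lambda>t. \<integral>\<xi>. norm (Ln (1 - \<xi> * cis t)) + 5 \<partial>m)"
  have "bmo_boundary (log_potential m) boundary_potential H (36 * measure m (space m))"
  proof (rule bmo_boundaryI[OF potential_holomorphic _ _ _ boundary_potential_oscillation])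
    have "integrable (m \<Otimes>\<^sub>M lborel) (\<lambda>(\<xi>, t). norm (indicat_real {0..2 * pi} t *\<^sub>R Ln (1 - \<xi> * cis t)))"
      using integrable_norm[OF kernel_integrable_product[of 0 "2 * pi"]] by (simp add: case_prod_unfold)
    from P.integrable_snd[OF this]
    have "set_integrable lborel {0..2 * pi} (\<lambda>t. \<integral>\<xi>. norm (Ln (1 - \<xi> * cis t)) \<partial>m)"
      by (simp add: set_integrable_def)
    then have "set_integrable lborel {0..2 * pi} (\<lambda>t. (\<integral>\<xi>. norm (Ln (1 - \<xi> * cis t)) \<partial>m) + 5 * measure m (space m))"
      by (intro set_integral_add) auto
    then show "set_integrable lborel {0..2 * pi} H"
      unfolding set_integrable_def
    proof (rule integrable_cong_AE_imp)
      show "AE t in lborel. indicat_real {0..2 * pi} t *\<^sub>R ((\<integral>\<xi>. norm (Ln (1 - \<xi> * cis t)) \<partial>m) + 5 * measure m (space m))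
          = indicat_real {0..2 * pi} t *\<^sub>R H t"
        using AE_kernel_integrable by eventually_elim (simp add: H_def)
      show "(\<lambda>t. indicat_real {0..2 * pi} t *\<^sub>R H t) \<in> borel_measurable lborel"
        unfolding H_def by measurable
    qed
    show "AE t in lborel. (\<forall>r\<in>{0..<1}. norm (log_potential m (of_real r * cis t)) \<le> H t) \<and>
         ((\<lambda>r. log_potential m (of_real r * cis t)) \<longlongrightarrow> boundary_potential t) (at_left 1)"
      using AE_kernel_integrable AE_kernel_regular
      by eventually_elim (use radial_limit in \<open>auto simp: H_def\<close>)
    show "set_integrable lborel {a..b} boundary_potential" if "a < b" "b \<le> a + 2 * pi" for a b
      using P.integrable_snd[OF kernel_integrable_product[OF that]]
      by (simp add: set_integrable_def boundary_potential_def)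
  qed
  then show ?thesis by (auto simp: radial_bmo_def)
qed

end

section \<open>Finiteness of the variations\<close>

text \<open>
  If \<open>\<nu>\<close> is unbounded on the subsets of \<open>A\<close>, then \<open>A\<close> splits into two sets with \<open>|\<nu>| > 1\<close>, and \<open>\<nu>\<close>
  is unbounded on the subsets of one of them. Repeating this with that part, the other parts form a
  disjoint sequence whose series of \<open>\<nu>\<close>-values diverges.
\<close>
lemma countably_additive_bounded:
  fixes \<nu> :: "'a set \<Rightarrow> real"
  assumes ca: "\<And>A :: nat \<Rightarrow> 'a set. range A \<subseteq> sets M \<Longrightarrow> disjoint_family A \<Longrightarrow> (\<lambda>i. \<nu> (A i)) sums \<nu> (\<Union>i. A i)"
  obtains C where "\<And>A. A \<in> sets M \<Longrightarrow> \<bar>\<nu> A\<bar> \<le> C"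
proof -
  have "(\<lambda>i::nat. \<nu> {}) sums \<nu> {}" using ca[of "\<lambda>_. {}"] by (simp add: disjoint_family_on_def)
  then have empty: "\<nu> {} = 0" by (metis sums_summable summable_const_iff)
  have Un: "\<nu> (A \<union> B) = \<nu> A + \<nu> B" if "A \<in> sets M" "B \<in> sets M" "A \<inter> B = {}" for A B
  proof -
    have "(\<lambda>i. \<nu> (binaryset A B i)) sums \<nu> (\<Union>i. binaryset A B i)"
      using that by (intro ca) (auto simp: range_binaryset_eq disjoint_family_on_def binaryset_def)
    then have "(\<lambda>i. \<nu> (binaryset A B i)) sums \<nu> (A \<union> B)" by (simp add: UN_binaryset_eq)
    moreover have "(\<lambda>i. \<nu> (binaryset A B i)) sums (\<nu> A + \<nu> B)"
      by (rule binaryset_sums) (rule empty)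
    ultimately show ?thesis by (rule sums_unique2)
  qed
  define bad where "bad = (\<lambda>A. A \<in> sets M \<and> (\<forall>C. \<exists>B\<in>sets M. B \<subseteq> A \<and> \<bar>\<nu> B\<bar> > C))"
  have step: "\<exists>B. bad B \<and> B \<subseteq> A \<and> \<bar>\<nu> (A - B)\<bar> > 1" if A: "bad A" for A
  proof -
    have Am: "A \<in> sets M" using A by (simp add: bad_def)
    obtain E where E: "E \<in> sets M" "E \<subseteq> A" "\<bar>\<nu> E\<bar> > 1 + \<bar>\<nu> A\<bar>" using A unfolding bad_def by meson
    have split: "\<nu> A = \<nu> E + \<nu> (A - E)"
      using Un[of E "A - E"] E Am by (simp add: Un_absorb1 sets.Diff)
    have "bad E \<or> bad (A - E)"
    proof (rule ccontr)
      assume "\<not> ?thesis"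
      then obtain C D where C: "\<And>B. B \<in> sets M \<Longrightarrow> B \<subseteq> E \<Longrightarrow> \<bar>\<nu> B\<bar> \<le> C"
        and D: "\<And>B. B \<in> sets M \<Longrightarrow> B \<subseteq> A - E \<Longrightarrow> \<bar>\<nu> B\<bar> \<le> D"
        using E Am unfolding bad_def by (meson not_le sets.Diff)
      obtain B where B: "B \<in> sets M" "B \<subseteq> A" "\<bar>\<nu> B\<bar> > C + D" using A unfolding bad_def by meson
      have "\<nu> B = \<nu> (B \<inter> E) + \<nu> (B - E)"
        using Un[of "B \<inter> E" "B - E"] B E by (simp add: Int_Diff_Un Int_Diff_disjoint sets.Diff sets.Int)
      moreover have "\<bar>\<nu> (B \<inter> E)\<bar> \<le> C" "\<bar>\<nu> (B - E)\<bar> \<le> D" using B E by (auto intro!: C D)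
      ultimately show False using B(3) by linarith
    qed
    then show ?thesis
    proof
      assume "bad E"
      then show ?thesis using E split by (intro exI[of _ E]) auto
    next
      assume "bad (A - E)"
      moreover have "A - (A - E) = E" using E by auto
      ultimately show ?thesis using E by (intro exI[of _ "A - E"]) auto
    qed
  qed
  have "\<not> bad (space M)"
  proof
    assume "bad (space M)"
    then obtain A where A: "\<And>n::nat. bad (A n)" "\<And>n. A (Suc n) \<subseteq> A n" "\<And>n. \<bar>\<nu> (A n - A (Suc n))\<bar> > 1"
      using dependent_nat_choice[of "\<lambda>_. bad" "\<lambda>_ A B. B \<subseteq> A \<and> \<bar>\<nu> (A - B)\<bar> > 1"] step by metis
    have anti: "A n \<subseteq> A m" if "m \<le> n" for m n using A(2) that by (rule lift_Suc_antimono_le)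
    have "disjoint_family (\<lambda>n. A n - A (Suc n))"
      unfolding disjoint_family_on_def
    proof (intro ballI impI)
      fix m n :: nat assume "m \<noteq> n"
      then have "Suc m \<le> n \<or> Suc n \<le> m" by linarith
      then show "(A m - A (Suc m)) \<inter> (A n - A (Suc n)) = {}"
        using anti[of "Suc m" n] anti[of "Suc n" m] by blast
    qed
    moreover have "range (\<lambda>n. A n - A (Suc n)) \<subseteq> sets M" using A(1) by (auto simp: bad_def)
    ultimately have "summable (\<lambda>n. \<nu> (A n - A (Suc n)))" using ca sums_summable by blast
    then have "(\<lambda>n. \<nu> (A n - A (Suc n))) \<longlonglongrightarrow> 0" by (rule summable_LIMSEQ_zero)
    then have "\<forall>\<^sub>F n in sequentially. \<bar>\<nu> (A n - A (Suc n))\<bar> < 1"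
      using order_tendstoD(2)[OF tendsto_rabs_zero] by fastforce
    then obtain n where "\<bar>\<nu> (A n - A (Suc n))\<bar> < 1" by (auto simp: eventually_sequentially)
    with A(3)[of n] show False by simp
  qed
  then obtain C where "\<And>B. B \<in> sets M \<Longrightarrow> B \<subseteq> space M \<Longrightarrow> \<bar>\<nu> B\<bar> \<le> C"
    unfolding bad_def by (meson not_le sets.top)
  then show ?thesis using that sets.sets_into_space by metis
qed

lemma space_circle_borel [simp]: "space circle_borel = sphere 0 1"
  by (simp add: circle_borel_def space_restrict_space)

lemma
  shows space_positive_variation [simp]: "space (positive_variation \<nu>) = sphere 0 1"
    and sets_positive_variation [simp, measurable_cong]: "sets (positive_variation \<nu>) = sets circle_borel"
proof -
  have *: "sigma_sets (sphere 0 1) (sets circle_borel) = sets circle_borel"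
    using sets.sigma_sets_eq[of circle_borel] by simp
  have **: "sets circle_borel \<subseteq> Pow (sphere 0 1)"
    using sets.space_closed[of circle_borel] by simp
  show "space (positive_variation \<nu>) = sphere 0 1" "sets (positive_variation \<nu>) = sets circle_borel"
    using * ** by (auto simp: positive_variation_def space_measure_of_conv sets_measure_of_conv)
qed

text \<open>
  Only the finiteness of \<^const>\<open>positive_variation\<close> is needed, not that its defining supremum is
  countably additive: \<^const>\<open>measure_of\<close> yields the zero measure if it is not.
\<close>
lemma finite_measure_positive_variation:
  assumes "\<And>A :: nat \<Rightarrow> complex set. range A \<subseteq> sets circle_borel \<Longrightarrow> disjoint_family A \<Longrightarrow>
    (\<lambda>i. \<nu> (A i)) sums \<nu> (\<Union>i. A i)"
  shows "finite_measure (positive_variation \<nu>)"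
proof
  obtain C where C: "\<And>A. A \<in> sets circle_borel \<Longrightarrow> \<bar>\<nu> A\<bar> \<le> C"
    using countably_additive_bounded[of circle_borel \<nu>] assms by blast
  have "(SUP B\<in>{B \<in> sets circle_borel. B \<subseteq> sphere 0 1}. ennreal (\<nu> B)) \<le> ennreal C"
  proof (rule SUP_least)
    fix B assume "B \<in> {B \<in> sets circle_borel. B \<subseteq> sphere 0 1}"
    then show "ennreal (\<nu> B) \<le> ennreal C" using C[of B] by (intro ennreal_leI) auto
  qed
  then have "emeasure (positive_variation \<nu>) (sphere 0 1) \<le> ennreal C"
    by (auto simp: positive_variation_def emeasure_measure_of_conv)
  then show "emeasure (positive_variation \<nu>) (space (positive_variation \<nu>)) \<noteq> \<infinity>"
    by (auto simp: top_unique)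
qed

section \<open>The class J\<close>

lemma Ln_quotient:
  assumes "norm \<xi> = 1" "norm z < 1"
  shows "Ln ((1 - \<xi> * z) / (1 - cnj \<xi> * z)) = Ln (1 - \<xi> * z) - Ln (1 - cnj \<xi> * z)"
proof -
  have pos: "Re (1 - w) > 0" if "norm w < 1" for w
    using that complex_Re_le_cmod[of w] by simp
  have a: "Re (1 - \<xi> * z) > 0" and b: "Re (1 - cnj \<xi> * z) > 0"
    using assms by (auto intro!: pos simp del: minus_complex.sel simp: norm_mult)
  have "\<bar>Im (Ln (1 - \<xi> * z))\<bar> < pi / 2" "\<bar>Im (Ln (1 - cnj \<xi> * z))\<bar> < pi / 2"
    by (rule Re_Ln_pos_lt_imp[OF a], rule Re_Ln_pos_lt_imp[OF b])
  then have "Ln (exp (Ln (1 - \<xi> * z) - Ln (1 - cnj \<xi> * z))) = Ln (1 - \<xi> * z) - Ln (1 - cnj \<xi> * z)"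
    by (intro Ln_exp) auto
  moreover have "1 - \<xi> * z \<noteq> 0" "1 - cnj \<xi> * z \<noteq> 0" using a b by force+
  ultimately show ?thesis by (simp add: exp_diff)
qed

lemma circle_measure_distr:
  assumes fin: "finite_measure N" and sp: "space N = sphere 0 1" and sets: "sets N = sets circle_borel"
    and u: "u \<in> borel_measurable borel" "\<And>\<xi>. norm (u \<xi>) = norm \<xi>"
  shows "circle_measure (distr N borel u)"
    and "log_potential (distr N borel u) z = (\<integral>\<xi>. Ln (1 - u \<xi> * z) \<partial>N)"
    and "norm z < 1 \<Longrightarrow> integrable N (\<lambda>\<xi>. Ln (1 - u \<xi> * z))"
proof -
  have [measurable]: "u \<in> N \<rightarrow>\<^sub>M borel"
    using u(1) by (subst measurable_cong_sets[OF sets refl]) (auto simp: circle_borel_def intro: measurable_restrict_space1)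
  interpret N: finite_measure N by (rule fin)
  show c: "circle_measure (distr N borel u)"
  proof (intro circle_measure.intro circle_measure_axioms.intro N.finite_measure_distr)
    show "AE \<xi> in distr N borel u. norm \<xi> = 1"
      using sp u(2) by (subst AE_distr_iff) auto
  qed auto
  interpret c: circle_measure "distr N borel u" by (rule c)
  show "log_potential (distr N borel u) z = (\<integral>\<xi>. Ln (1 - u \<xi> * z) \<partial>N)"
    unfolding log_potential_def by (rule integral_distr) measurable
  show "integrable N (\<lambda>\<xi>. Ln (1 - u \<xi> * z))" if "norm z < 1"
    using c.potential_integrable[OF that] by (subst (asm) integrable_distr_eq) measurable
qed

lemma radial_bmo_kernel_integral:
  assumes ca: "\<And>A :: nat \<Rightarrow> complex set. range A \<subseteq> sets circle_borel \<Longrightarrow> disjoint_family A \<Longrightarrow>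
    (\<lambda>i. \<nu> (A i)) sums \<nu> (\<Union>i. A i)"
  obtains F where "radial_bmo F" 
    "\<And>z. norm z < 1 \<Longrightarrow> (\<integral>\<xi>. Ln ((1 - \<xi> * z) / (1 - cnj \<xi> * z)) \<partial>positive_variation \<nu>) = F z"
proof -
  let ?N = "positive_variation \<nu>"
  have fin: "finite_measure ?N" by (rule finite_measure_positive_variation) (rule ca)
  note D = circle_measure_distr[OF fin space_positive_variation sets_positive_variation]
  have id: "(\<lambda>\<xi>. \<xi>) \<in> borel_measurable (borel :: complex measure)"
    and cnj: "cnj \<in> borel_measurable borel"
    by (auto intro!: borel_measurable_continuous_onI continuous_intros)
  let ?A = "log_potential (distr ?N borel (\<lambda>\<xi>. \<xi>))" and ?B = "log_potential (distr ?N borel cnj)"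
  have "radial_bmo (\<lambda>z. ?A z + (- 1) * ?B z)"
    by (intro radial_bmo_add radial_bmo_cmult circle_measure.radial_bmo_log_potential D(1) id cnj refl complex_mod_cnj)
  moreover have "(\<integral>\<xi>. Ln ((1 - \<xi> * z) / (1 - cnj \<xi> * z)) \<partial>?N) = ?A z + (- 1) * ?B z" if z: "norm z < 1" for z
  proof -
    have "(\<integral>\<xi>. Ln ((1 - \<xi> * z) / (1 - cnj \<xi> * z)) \<partial>?N) = (\<integral>\<xi>. Ln (1 - \<xi> * z) - Ln (1 - cnj \<xi> * z) \<partial>?N)"
      using z by (intro Bochner_Integration.integral_cong refl Ln_quotient) auto
    also have "\<dots> = (\<integral>\<xi>. Ln (1 - \<xi> * z) \<partial>?N) - (\<integral>\<xi>. Ln (1 - cnj \<xi> * z) \<partial>?N)"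
      using D(3)[OF id refl z] D(3)[OF cnj complex_mod_cnj z] by (rule Bochner_Integration.integral_diff)
    finally show ?thesis using D(2)[OF id refl] D(2)[OF cnj complex_mod_cnj] by simp
  qed
  ultimately show ?thesis using that by blast
qed

theorem mainTheorem4: "J_class \<subseteq> BMOA"
proof
  fix f assume "f \<in> J_class"
  then obtain \<mu> where \<mu>: "\<mu> \<in> complex_borel_measures" and f: "\<And>z. z \<in> ball 0 1 \<Longrightarrow> f z = J_fun \<mu> z"
    unfolding J_class_def by blast
  have ca: "(\<lambda>i. \<mu> (A i)) sums \<mu> (\<Union>i. A i)"
    if "range A \<subseteq> sets circle_borel" "disjoint_family A" for A :: "nat \<Rightarrow> complex set"
    using \<mu> that unfolding complex_borel_measures_def by blast
  obtain F1 where F1: "radial_bmo F1" "\<And>z. norm z < 1 \<Longrightarrow>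
      (\<integral>\<xi>. Ln ((1 - \<xi> * z) / (1 - cnj \<xi> * z)) \<partial>positive_variation (\<lambda>A. Re (\<mu> A))) = F1 z"
    using radial_bmo_kernel_integral[OF sums_Re[OF ca]] by blast
  obtain F2 where F2: "radial_bmo F2" "\<And>z. norm z < 1 \<Longrightarrow>
      (\<integral>\<xi>. Ln ((1 - \<xi> * z) / (1 - cnj \<xi> * z)) \<partial>positive_variation (\<lambda>A. - Re (\<mu> A))) = F2 z"
    using radial_bmo_kernel_integral[OF sums_minus[OF sums_Re[OF ca]]] by blast
  obtain F3 where F3: "radial_bmo F3" "\<And>z. norm z < 1 \<Longrightarrow>
      (\<integral>\<xi>. Ln ((1 - \<xi> * z) / (1 - cnj \<xi> * z)) \<partial>positive_variation (\<lambda>A. Im (\<mu> A))) = F3 z"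
    using radial_bmo_kernel_integral[OF sums_Im[OF ca]] by blast
  obtain F4 where F4: "radial_bmo F4" "\<And>z. norm z < 1 \<Longrightarrow>
      (\<integral>\<xi>. Ln ((1 - \<xi> * z) / (1 - cnj \<xi> * z)) \<partial>positive_variation (\<lambda>A. - Im (\<mu> A))) = F4 z"
    using radial_bmo_kernel_integral[OF sums_minus[OF sums_Im[OF ca]]] by blast
  have "radial_bmo (\<lambda>z. (F1 z + (- 1) * F2 z) + \<i> * (F3 z + (- 1) * F4 z))"
    by (intro radial_bmo_add radial_bmo_cmult F1(1) F2(1) F3(1) F4(1))
  then show "f \<in> BMOA"
    by (rule radial_bmo_in_BMOA) (simp add: f J_fun_def complex_measure_integral_def F1(2) F2(2) F3(2) F4(2))
qed

end
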